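(* Let $\Omega\subset\mathbb{R}^n$ be a compact set, $f\in C(\Omega)$ real-valued, $\rho:\mathbb{R}\to\mathbb{R}$ monotonically (strictly) decreasing with $\rho(f(x))>0$ for every $x\in\Omega$, $\tau(x)=\rho(f(x))$, and $m^{(k)}(x)=\tau^k(x)/\int_\Omega\tau^k(t)\,\mathrm{d}t$ for $x\in\Omega$, $k\in\mathbb{R}$. Let $$D_f^{(k)}=\left\{x\in\Omega:f(x)\leqslant\int_\Omega f(t)\,m^{(k)}(t)\,\mathrm{d}t\right\}.$$ For all $k\in\mathbb{R}$ and $\Delta k>0$, $$\Omega\supseteq D_f^{(k)}\supseteq D_f^{(k+\Delta k)}\supseteq X^*,$$ where $X^*$ is the set of all global minimizers of $f$ in $\Omega$. In particular, if $\tau=e^{-f}$ and $f$ is not constant on $\Omega$, then $\Omega\supsetneq D_f^{(k)}\supsetneq D_f^{(k+\Delta k)}\supsetneq X^*$.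
   Context: Integrals are with respect to $n$-dimensional Lebesgue measure $\mu$; it is implicit in the definition of $m^{(k)}$ that $\mu(\Omega)>0$.
   Formalization: The strict chain is false for merely non-constant f (e.g. f two-valued on two disjoint intervals, or constant off a null set); it is proved assuming f is not almost everywhere constant on Ω and f(Ω) is connected (automatic if Ω is connected). *)

theory Defs
  imports "HOL-Analysis.Analysis"
begin

text \<open>
  The power has an arbitrary real exponent, hence \<open>powr\<close>; it is only meant for \<open>\<tau>\<close> positive
  on \<open>\<Omega>\<close>. Values of \<open>\<tau>\<close> outside \<open>\<Omega>\<close> play no role.
\<close>

definition min_density :: "(real^'n) set \<Rightarrow> (real^'n \<Rightarrow> real) \<Rightarrow> real \<Rightarrow> real^'n \<Rightarrow> real" where
  "min_density \<Omega> \<tau> k x = \<tau> x powr k / (LINT t:\<Omega>|lebesgue. \<tau> t powr k)"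

definition sig_dom ::
    "(real^'n) set \<Rightarrow> (real^'n \<Rightarrow> real) \<Rightarrow> (real^'n \<Rightarrow> real) \<Rightarrow> real \<Rightarrow> (real^'n) set" where
  "sig_dom \<Omega> f \<tau> k = {x \<in> \<Omega>. f x \<le> (LINT t:\<Omega>|lebesgue. f t * min_density \<Omega> \<tau> k t)}"

definition minimizers :: "'a set \<Rightarrow> ('a \<Rightarrow> real) \<Rightarrow> 'a set" where
  "minimizers \<Omega> f = {x. is_arg_min f (\<lambda>y. y \<in> \<Omega>) x}"

text \<open>
  Strict inclusions between the sets \<open>sig_dom \<Omega> f \<tau> k\<close> for varying \<open>k\<close> need more than \<open>f\<close> taking two
  different values on \<open>\<Omega>\<close>. If \<open>f\<close> takes exactly two values (possible when \<open>\<Omega>\<close> is disconnected), its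
  only sublevel sets in \<open>\<Omega>\<close> are the empty set, the set of minimizers and \<open>\<Omega>\<close>. If \<open>f\<close> is constant
  up to a null set (possible even for connected \<open>\<Omega>\<close> in dimension at least 2, such as a square with
  a segment attached), the weighted mean of \<open>f\<close> does not depend on \<open>k\<close>. Strictness is therefore
  stated for \<open>f\<close> that is not almost everywhere constant on \<open>\<Omega>\<close> and attains all values between its
  extrema; the latter is automatic when \<open>\<Omega>\<close> is connected.
\<close>

end

theory Submission
  imports Defs
begin

text \<open>
  Write \<open>A\<close> for the mean of \<open>f\<close> with weight \<open>w = \<tau> powr k\<close>, so that the integral of \<open>w (f - A)\<close>
  vanishes, and put \<open>h = \<tau> powr d\<close> with \<open>d > 0\<close>. As \<open>h\<close> is a decreasing function of \<open>f\<close>, the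
  integral of \<open>w h (f - A)\<close> equals that of \<open>w (f - A) (h - h0)\<close> with \<open>h0 = \<rho> A powr d\<close>, whose
  integrand is nonpositive. Hence the mean with weight \<open>w h = \<tau> powr (k + d)\<close> is at most \<open>A\<close>, and
  it equals \<open>A\<close> only if \<open>f = A\<close> almost everywhere. In the strict case the values \<open>A\<close> are attained
  by \<open>f\<close>, so that different means have different sublevel sets.
\<close>

text \<open>The weight is left unnormalised, so that passing from one exponent to the next is just
  multiplication of \<open>w\<close> by a further factor.\<close>

definition weighted_mean :: "'a measure \<Rightarrow> ('a \<Rightarrow> real) \<Rightarrow> ('a \<Rightarrow> real) \<Rightarrow> real" where
  "weighted_mean M w f = (LINT x|M. f x * w x) / (LINT x|M. w x)"

lemma integral_pos_if_pos:
  fixes w :: "'a \<Rightarrow> real"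
  assumes "integrable M w" and "\<And>x. x \<in> space M \<Longrightarrow> w x > 0" and "emeasure M (space M) \<noteq> 0"
  shows "(LINT x|M. w x) > 0"
proof -
  have nn: "AE x in M. 0 \<le> w x"
    using assms(2) by (auto intro: less_imp_le)
  have "(LINT x|M. w x) \<noteq> 0"
  proof
    assume "(LINT x|M. w x) = 0"
    then have "AE x in M. w x = 0"
      using integral_nonneg_eq_0_iff_AE[OF assms(1) nn] by simp
    then have "AE x in M. False"
      using AE_space by eventually_elim (use assms(2) in force)
    then show False
      using assms(3) by (simp add: AE_iff_measurable[OF sets.top])
  qed
  with integral_nonneg_AE[OF nn] show ?thesis by linarith
qed

text \<open>Turns a comparison of the mean with \<open>c\<close> into the sign of one integral; for
  \<open>c\<close> equal to the mean, that integral vanishes.\<close>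

lemma integral_diff_weighted_mean:
  assumes "integrable M w" and "integrable M (\<lambda>x. f x * w x)" and "(LINT x|M. w x) \<noteq> 0"
  shows "(LINT x|M. (f x - c) * w x) = (weighted_mean M w f - c) * (LINT x|M. w x)"
proof -
  have "(LINT x|M. (f x - c) * w x) = (LINT x|M. f x * w x) - c * (LINT x|M. w x)"
    using assms by (simp add: left_diff_distrib)
  then show ?thesis
    using assms(3) by (simp add: weighted_mean_def left_diff_distrib)
qed

lemma weighted_mean_uminus: "weighted_mean M w (\<lambda>x. - f x) = - weighted_mean M w f"
  by (simp add: weighted_mean_def)

text \<open>The integrand \<open>(f x - c) * w x\<close> is nonnegative. Since \<open>w\<close> is
  positive everywhere, its integral can vanish only if \<open>f = c\<close> almost
  everywhere.\<close>

lemma weighted_mean_ge: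
  assumes w: "integrable M w" "\<And>x. x \<in> space M \<Longrightarrow> w x > 0" and M: "emeasure M (space M) \<noteq> 0"
    and fw: "integrable M (\<lambda>x. f x * w x)" and ge: "\<And>x. x \<in> space M \<Longrightarrow> c \<le> f x"
  shows "c \<le> weighted_mean M w f"
    and "\<not> (AE x in M. f x = c) \<Longrightarrow> c < weighted_mean M w f"
proof -
  have pos: "(LINT x|M. w x) > 0"
    using integral_pos_if_pos[OF w M] .
  have int: "integrable M (\<lambda>x. (f x - c) * w x)"
    using w fw by (simp add: left_diff_distrib)
  have nn: "AE x in M. 0 \<le> (f x - c) * w x"
    using w(2) ge by (intro AE_I2 mult_nonneg_nonneg) (auto intro: less_imp_le)
  note eq = integral_diff_weighted_mean[OF w(1) fw, of c]
  show le: "c \<le> weighted_mean M w f"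
    using integral_nonneg_AE[OF nn] eq pos by (simp add: zero_le_mult_iff)
  assume nconst: "\<not> (AE x in M. f x = c)"
  have "weighted_mean M w f \<noteq> c"
  proof
    assume "weighted_mean M w f = c"
    then have "AE x in M. (f x - c) * w x = 0"
      using eq pos integral_nonneg_eq_0_iff_AE[OF int nn] by simp
    then have "AE x in M. f x = c"
      using AE_space by eventually_elim (use w(2) in force)
    with nconst show False ..
  qed
  with le show "c < weighted_mean M w f" by simp
qed

lemma weighted_mean_le:
  assumes w: "integrable M w" "\<And>x. x \<in> space M \<Longrightarrow> w x > 0" and M: "emeasure M (space M) \<noteq> 0"
    and fw: "integrable M (\<lambda>x. f x * w x)" and le: "\<And>x. x \<in> space M \<Longrightarrow> f x \<le> c"
  shows "weighted_mean M w f \<le> c"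
    and "\<not> (AE x in M. f x = c) \<Longrightarrow> weighted_mean M w f < c"
  using weighted_mean_ge[OF w M, of "\<lambda>x. - f x" "- c"] fw le
  by (simp_all add: weighted_mean_uminus)

text \<open>A Chebyshev-type inequality: the factor \<open>h\<close> favours the points where
  \<open>f\<close> lies below its mean. All that enters is that \<open>h\<close> crosses the level
  \<open>h0\<close> where \<open>f\<close> crosses its mean, since the deviation of \<open>f\<close>
  vanishes at the mean itself.\<close>

lemma weighted_mean_mult_decreasing:
  assumes w: "integrable M w" "\<And>x. x \<in> space M \<Longrightarrow> w x > 0" and M: "emeasure M (space M) \<noteq> 0"
    and fw: "integrable M (\<lambda>x. f x * w x)"
    and wh: "integrable M (\<lambda>x. w x * h x)" "\<And>x. x \<in> space M \<Longrightarrow> h x > 0"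
    and fwh: "integrable M (\<lambda>x. f x * (w x * h x))"
    and above: "\<And>x. x \<in> space M \<Longrightarrow> weighted_mean M w f < f x \<Longrightarrow> h x < h0"
    and below: "\<And>x. x \<in> space M \<Longrightarrow> f x < weighted_mean M w f \<Longrightarrow> h0 < h x"
  shows "weighted_mean M (\<lambda>x. w x * h x) f \<le> weighted_mean M w f"
    and "\<not> (AE x in M. f x = weighted_mean M w f) \<Longrightarrow>
      weighted_mean M (\<lambda>x. w x * h x) f < weighted_mean M w f"
proof -
  define A B where "A = weighted_mean M w f" and "B = weighted_mean M (\<lambda>x. w x * h x) f"
  have pos: "(LINT x|M. w x) > 0" "(LINT x|M. w x * h x) > 0"
    using integral_pos_if_pos[OF w M] integral_pos_if_pos[OF wh(1) _ M] w(2) wh(2) by auto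
  \<comment> \<open>The sign is chosen to make the integrand nonnegative; \<open>h0\<close> can be
    subtracted because \<open>w x * (f x - A)\<close> has integral zero.\<close>
  define g where "g x = w x * ((A - f x) * (h x - h0))" for x
  have int: "integrable M (\<lambda>x. (f x - A) * w x)" "integrable M (\<lambda>x. (f x - A) * (w x * h x))"
    using w fw wh fwh by (simp_all add: left_diff_distrib)
  have g_eq: "g = (\<lambda>x. h0 * ((f x - A) * w x) - (f x - A) * (w x * h x))"
    by (auto simp: g_def algebra_simps)
  have int_g: "integrable M g"
    unfolding g_eq using int by simp
  have "(LINT x|M. (f x - A) * w x) = 0"
    using integral_diff_weighted_mean[OF w(1) fw, of A] pos by (simp add: A_def)
  moreover have "(LINT x|M. (f x - A) * (w x * h x)) = (B - A) * (LINT x|M. w x * h x)"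
    using integral_diff_weighted_mean[OF wh(1) fwh, of A] pos by (simp add: B_def)
  ultimately have g_int: "(LINT x|M. g x) = (A - B) * (LINT x|M. w x * h x)"
    unfolding g_eq using int by (simp add: left_diff_distrib)
  \<comment> \<open>The factors \<open>A - f x\<close> and \<open>h x - h0\<close> have the same
    strict sign unless \<open>f x = A\<close>.\<close>
  have sgn: "0 \<le> g x" "g x = 0 \<Longrightarrow> f x = A" if "x \<in> space M" for x
  proof -
    have "0 \<le> (A - f x) * (h x - h0) \<and> ((A - f x) * (h x - h0) = 0 \<longrightarrow> f x = A)"
      using above[OF that] below[OF that]
      by (cases "f x" A rule: linorder_cases) (auto simp: A_def zero_le_mult_iff)
    with w(2)[OF that] show "0 \<le> g x" "g x = 0 \<Longrightarrow> f x = A"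
      by (auto simp: g_def)
  qed
  have nn: "AE x in M. 0 \<le> g x"
    using sgn(1) by auto
  have le: "B \<le> A"
    using integral_nonneg_AE[OF nn] g_int pos by (simp add: zero_le_mult_iff)
  then show "weighted_mean M (\<lambda>x. w x * h x) f \<le> weighted_mean M w f"
    by (simp add: A_def B_def)
  assume nconst: "\<not> (AE x in M. f x = weighted_mean M w f)"
  have "B \<noteq> A"
  proof
    assume "B = A"
    then have "AE x in M. g x = 0"
      using g_int integral_nonneg_eq_0_iff_AE[OF int_g nn] by simp
    then have "AE x in M. f x = A"
      using AE_space by eventually_elim (use sgn(2) in auto)
    with nconst show False by (simp add: A_def)
  qed
  with le show "weighted_mean M (\<lambda>x. w x * h x) f < weighted_mean M w f"
    by (simp add: A_def B_def)
qed

lemma sig_dom_eq_weighted_mean: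
  fixes \<Omega> :: "(real^'n) set"
  assumes "\<Omega> \<in> sets lebesgue"
  shows "sig_dom \<Omega> f \<tau> k =
    {x \<in> \<Omega>. f x \<le> weighted_mean (lebesgue_on \<Omega>) (\<lambda>x. \<tau> x powr k) f}"
proof -
  have set_int: "(LINT x:\<Omega>|lebesgue. g x) = integral\<^sup>L (lebesgue_on \<Omega>) g" for g :: "real^'n \<Rightarrow> real"
    using assms by (simp add: set_lebesgue_integral_def integral_restrict_space)
  show ?thesis
    by (simp add: sig_dom_def min_density_def set_int weighted_mean_def)
qed

text \<open>The power is increasing or decreasing according to the sign of \<open>k\<close>; the sum
  of the endpoint values bounds it in both cases.\<close>

lemma powr_le_sum_bounds:
  fixes a b y k :: real
  assumes "0 < a" "a \<le> y" "y \<le> b"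
  shows "y powr k \<le> a powr k + b powr k"
proof (cases "k \<ge> 0")
  case True
  then have "y powr k \<le> b powr k" using assms by (intro powr_mono2) auto
  then show ?thesis by (simp add: add_increasing)
next
  case False
  then have "y powr k \<le> a powr k" using assms by (intro powr_mono2') auto
  then show ?thesis by (simp add: add_increasing2)
qed

text \<open>\<open>\<rho>\<close> may have jumps, so measurability of \<open>\<tau>\<close> has to
  come from monotonicity.\<close>

lemma borel_measurable_strict_antimono:
  fixes \<rho> :: "real \<Rightarrow> real"
  assumes "\<And>s t. s < t \<Longrightarrow> \<rho> t < \<rho> s"
  shows "\<rho> \<in> borel_measurable borel"
proof -
  have "mono (\<lambda>x. - \<rho> x)"
    using assms by (intro monoI) (metis less_eq_real_def neg_le_iff_le)
  then have "(\<lambda>x. - (- \<rho> x)) \<in> borel_measurable borel"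
    by (intro borel_measurable_uminus borel_measurable_mono)
  then show ?thesis by simp
qed

theorem theorem8:
  fixes \<Omega> :: "(real^'n) set" and f \<tau> :: "real^'n \<Rightarrow> real" and \<rho> :: "real \<Rightarrow> real"
  assumes "compact \<Omega>"
    and "measure lebesgue \<Omega> > 0"
    and "continuous_on \<Omega> f"
    and "\<And>s t. s < t \<Longrightarrow> \<rho> t < \<rho> s"
    and "\<And>x. x \<in> \<Omega> \<Longrightarrow> \<rho> (f x) > 0"
    and "\<And>x. x \<in> \<Omega> \<Longrightarrow> \<tau> x = \<rho> (f x)"
  shows "(\<forall>k \<Delta>k. \<Delta>k > 0 \<longrightarrow>
            \<Omega> \<supseteq> sig_dom \<Omega> f \<tau> k \<and>
            sig_dom \<Omega> f \<tau> k \<supseteq> sig_dom \<Omega> f \<tau> (k + \<Delta>k) \<and>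
            sig_dom \<Omega> f \<tau> (k + \<Delta>k) \<supseteq> minimizers \<Omega> f) \<and>
         ((\<forall>x\<in>\<Omega>. \<tau> x = exp (- f x)) \<and>
          \<not> (\<exists>c. AE x in lebesgue. x \<in> \<Omega> \<longrightarrow> f x = c) \<and> connected (f ` \<Omega>) \<longrightarrow>
          (\<forall>k \<Delta>k. \<Delta>k > 0 \<longrightarrow>
            \<Omega> \<supset> sig_dom \<Omega> f \<tau> k \<and>
            sig_dom \<Omega> f \<tau> k \<supset> sig_dom \<Omega> f \<tau> (k + \<Delta>k) \<and>
            sig_dom \<Omega> f \<tau> (k + \<Delta>k) \<supset> minimizers \<Omega> f))"
proof -
  note cont = assms(3) and dec = assms(4) and pos = assms(5) and tau = assms(6)
  define M where "M = lebesgue_on \<Omega>"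
  have meas: "\<Omega> \<in> lmeasurable"
    using assms(1) by (rule lmeasurable_compact)
  then have sets: "\<Omega> \<in> sets lebesgue" by (rule fmeasurableD)
  have sp: "space M = \<Omega>" by (simp add: M_def)
  have M0: "emeasure M (space M) \<noteq> 0"
    using assms(2) sets by (auto simp: M_def emeasure_restrict_space measure_def)
  interpret finite_measure M
    unfolding M_def using meas by (rule finite_measure_lebesgue_on)
  have "\<Omega> \<noteq> {}" using assms(2) by auto
  then obtain xl xu where xl: "xl \<in> \<Omega>" "\<And>y. y \<in> \<Omega> \<Longrightarrow> f xl \<le> f y"
    and xu: "xu \<in> \<Omega>" "\<And>y. y \<in> \<Omega> \<Longrightarrow> f y \<le> f xu"
    using continuous_attains_inf[OF assms(1) _ cont] continuous_attains_sup[OF assms(1) _ cont]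
    by metis
  have anti: "\<rho> t \<le> \<rho> s" if "s \<le> t" for s t
    using dec[of s t] that by (cases "s = t") auto
  have tau_pos: "\<tau> x > 0" if "x \<in> \<Omega>" for x
    using pos tau that by simp
  \<comment> \<open>\<open>\<rho>\<close> reverses the order, so the maximum of \<open>f\<close>
    gives a positive lower bound for \<open>\<tau>\<close>. This keeps
    \<open>\<tau> x powr k\<close> bounded for negative \<open>k\<close> too.\<close>
  have tau_bounds: "\<rho> (f xu) \<le> \<tau> x" "\<tau> x \<le> \<rho> (f xl)" if "x \<in> \<Omega>" for x
    using tau[OF that] anti xl(2)[OF that] xu(2)[OF that] by auto
  have f_meas [measurable]: "f \<in> borel_measurable M"
    unfolding M_def using cont sets by (rule continuous_imp_measurable_on_sets_lebesgue)
  have [measurable]: "\<rho> \<in> borel_measurable borel"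
    using dec by (rule borel_measurable_strict_antimono)
  have [measurable]: "\<tau> \<in> borel_measurable M"
    by (subst measurable_cong[where g = "\<lambda>x. \<rho> (f x)"]) (use tau sp in auto)
  define C where "C k = \<rho> (f xu) powr k + \<rho> (f xl) powr k" for k
  have C: "\<tau> x powr k \<le> C k" if "x \<in> \<Omega>" for x k
    unfolding C_def using tau_bounds[OF that] pos[OF xu(1)] by (intro powr_le_sum_bounds)
  have int: "integrable M (\<lambda>x. \<tau> x powr k)" for k
    by (rule integrable_const_bound[where B = "C k"]) (use C sp in auto)
  define F where "F = \<bar>f xl\<bar> + \<bar>f xu\<bar>"
  have F: "\<bar>f x\<bar> \<le> F" if "x \<in> \<Omega>" for x
    using xl(2)[OF that] xu(2)[OF that] by (auto simp: F_def)
  have fint: "integrable M (\<lambda>x. f x * \<tau> x powr k)" for k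
  proof (rule integrable_const_bound[where B = "F * C k"])
    show "AE x in M. norm (f x * \<tau> x powr k) \<le> F * C k"
    proof (rule AE_I2)
      fix x assume "x \<in> space M"
      then have "x \<in> \<Omega>" by (simp add: sp)
      have "\<bar>f x\<bar> * \<tau> x powr k \<le> F * C k"
        using F[OF \<open>x \<in> \<Omega>\<close>] C[OF \<open>x \<in> \<Omega>\<close>] by (intro mult_mono) (auto simp: F_def)
      then show "norm (f x * \<tau> x powr k) \<le> F * C k"
        by (simp add: abs_mult)
    qed
  qed measurable
  have wpos: "\<tau> x powr k > 0" if "x \<in> space M" for x k
    using tau_pos[of x] that sp by simp
  define A where "A k = weighted_mean M (\<lambda>x. \<tau> x powr k) f" for k
  have sd: "sig_dom \<Omega> f \<tau> k = {x \<in> \<Omega>. f x \<le> A k}" for k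
    unfolding A_def M_def by (rule sig_dom_eq_weighted_mean[OF sets])
  note lower = weighted_mean_ge[OF int wpos M0 fint, of "f xl", folded A_def]
  note upper = weighted_mean_le[OF int wpos M0 fint, of "f xu", folded A_def]
  have A_lower: "f xl \<le> A k" and A_upper: "A k \<le> f xu" for k
    using lower(1) upper(1) xl(2) xu(2) sp by auto
  have decr: "A (k + d) \<le> A k" "\<not> (AE x in M. f x = A k) \<Longrightarrow> A (k + d) < A k"
    if "d > 0" for k d
  proof -
    \<comment> \<open>\<open>A k\<close> need not be a value of \<open>f\<close> here, so positivity
      is inherited from the maximum \<open>f xu\<close>.\<close>
    have "\<rho> (A k) > 0"
      using anti[OF A_upper] pos[OF xu(1)] by (rule less_le_trans[rotated])
    then have h: "\<And>x. x \<in> space M \<Longrightarrow> A k < f x \<Longrightarrow> \<tau> x powr d < \<rho> (A k) powr d"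
      "\<And>x. x \<in> space M \<Longrightarrow> f x < A k \<Longrightarrow> \<rho> (A k) powr d < \<tau> x powr d"
      using dec tau pos that sp by (auto intro!: powr_less_mono2 simp: less_imp_le)
    have eq: "\<tau> x powr k * \<tau> x powr d = \<tau> x powr (k + d)" for x
      by (simp add: powr_add)
    note * = weighted_mean_mult_decreasing[OF int wpos M0 fint, of k "\<lambda>x. \<tau> x powr d" "\<rho> (A k) powr d",
      unfolded eq, folded A_def]
    show "A (k + d) \<le> A k"
      by (rule *(1)) (use h int wpos fint in auto)
    show "A (k + d) < A k" if "\<not> (AE x in M. f x = A k)"
      by (rule *(2)) (use h int wpos fint that in auto)
  qed
  have mins: "minimizers \<Omega> f = {x \<in> \<Omega>. f x = f xl}"
    using xl unfolding minimizers_def is_arg_min_linorder by (auto intro: antisym)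
  have weak: "\<Omega> \<supseteq> sig_dom \<Omega> f \<tau> k \<and> sig_dom \<Omega> f \<tau> k \<supseteq> sig_dom \<Omega> f \<tau> (k + d) \<and>
      sig_dom \<Omega> f \<tau> (k + d) \<supseteq> minimizers \<Omega> f" if "d > 0" for k d
    using decr(1)[OF that, of k] A_lower[of "k + d"] by (auto simp: sd mins)
  have strict: "\<Omega> \<supset> sig_dom \<Omega> f \<tau> k \<and> sig_dom \<Omega> f \<tau> k \<supset> sig_dom \<Omega> f \<tau> (k + d) \<and>
      sig_dom \<Omega> f \<tau> (k + d) \<supset> minimizers \<Omega> f"
    if "d > 0" and nconst: "\<not> (\<exists>c. AE x in lebesgue. x \<in> \<Omega> \<longrightarrow> f x = c)"
      and conn: "connected (f ` \<Omega>)" for k d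
  proof -
    have nc: "\<not> (AE x in M. f x = c)" for c
      using nconst sets AE_restrict_space_iff[of \<Omega> lebesgue "\<lambda>x. f x = c"] unfolding M_def by auto
    \<comment> \<open>A connected set of reals contains every number between two of its elements,
      here the extrema of \<open>f\<close>.\<close>
    have attained: "A j \<in> f ` \<Omega>" for j
      by (rule connectedD_interval[OF conn imageI[OF xl(1)] imageI[OF xu(1)] A_lower A_upper])
    obtain x y where x: "x \<in> \<Omega>" "f x = A k" and y: "y \<in> \<Omega>" "f y = A (k + d)"
      using imageE[OF attained[of k]] imageE[OF attained[of "k + d"]] by metis
    have "A k < f xu"
      by (rule upper(2)) (use xu(2) sp nc in auto)
    moreover have "f xl < A (k + d)"
      by (rule lower(2)) (use xl(2) sp nc in auto)
    moreover have "A (k + d) < A k"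
      using decr(2)[OF that(1) nc] .
    \<comment> \<open>One witness for each strict inclusion: a maximizer, a point at level
      \<open>A k\<close>, and a point at level \<open>A (k + d)\<close>, which lies strictly above
      the minimum.\<close>
    ultimately have "xu \<in> \<Omega> - sig_dom \<Omega> f \<tau> k" "x \<in> sig_dom \<Omega> f \<tau> k - sig_dom \<Omega> f \<tau> (k + d)"
      "y \<in> sig_dom \<Omega> f \<tau> (k + d) - minimizers \<Omega> f"
      using x y xu(1) by (auto simp: sd mins)
    with weak[OF that(1), of k] show ?thesis by blast
  qed
  show ?thesis
  proof (rule conjI; intro allI impI)
    fix k d :: real assume "d > 0"
    then show "\<Omega> \<supseteq> sig_dom \<Omega> f \<tau> k \<and> sig_dom \<Omega> f \<tau> k \<supseteq> sig_dom \<Omega> f \<tau> (k + d) \<and>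
      sig_dom \<Omega> f \<tau> (k + d) \<supseteq> minimizers \<Omega> f" by (rule weak)
  next
    fix k d :: real
    assume "(\<forall>x\<in>\<Omega>. \<tau> x = exp (- f x)) \<and>
      \<not> (\<exists>c. AE x in lebesgue. x \<in> \<Omega> \<longrightarrow> f x = c) \<and> connected (f ` \<Omega>)" and "d > 0"
    then show "\<Omega> \<supset> sig_dom \<Omega> f \<tau> k \<and> sig_dom \<Omega> f \<tau> k \<supset> sig_dom \<Omega> f \<tau> (k + d) \<and>
      sig_dom \<Omega> f \<tau> (k + d) \<supset> minimizers \<Omega> f" by (intro strict) simp_all
  qed
qed

end
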